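(* Let $\mathbb{F}$ be a field of characteristic zero. The automorphisms of $K_3^{1/2}$ are exactly the linear mappings $\phi$ given by $\phi(e)=e$, $\phi(z)=\varepsilon z+kw$, $\phi(w)=\varepsilon w$, where $\varepsilon\in\{1,-1\}$ and $k\in\mathbb{F}$.
   Context: $K_3^{1/2}$ is the superalgebra over $\mathbb{F}$ with even part $\langle e\rangle$, odd part $\langle z,w\rangle$ (so $e,z,w$ is a basis) and multiplication $e^2=e$, $ez=\frac12z+\frac12w$, $ew=\frac12w$, $ze=\frac12z-\frac12w$, $we=\frac12w$, $z^2=-e$, $zw=e$, $wz=-e$, $w^2=0$. An automorphism is a bijective linear map $\phi$ with $\phi(ab)=\phi(a)\phi(b)$ for all $a,b$. *)

theory Defs
  imports "HOL-Analysis.Cartesian_Space"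
begin

datatype K3_index = E | Z | W

lemma UNIV_K3_index: "UNIV = {E, Z, W}"
  using K3_index.exhaust by auto

instance K3_index :: finite
  by standard (simp add: UNIV_K3_index)

type_synonym 'a K3 = "'a ^ K3_index"

definition e :: "'a::field K3" where "e = axis E 1"
definition z :: "'a::field K3" where "z = axis Z 1"
definition w :: "'a::field K3" where "w = axis W 1"

fun K3_table :: "K3_index \<Rightarrow> K3_index \<Rightarrow> 'a::field K3" where
  "K3_table E E = e"
| "K3_table E Z = (1/2) *s z + (1/2) *s w"
| "K3_table E W = (1/2) *s w"
| "K3_table Z E = (1/2) *s z - (1/2) *s w"
| "K3_table W E = (1/2) *s w"
| "K3_table Z Z = - e"
| "K3_table Z W = e"
| "K3_table W Z = - e"
| "K3_table W W = 0"

definition K3_mult :: "'a::field K3 \<Rightarrow> 'a K3 \<Rightarrow> 'a K3" (infixl "\<bullet>\<^sub>K" 70) where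
  "x \<bullet>\<^sub>K y = (\<Sum>i\<in>UNIV. \<Sum>j\<in>UNIV. (x $ i * y $ j) *s K3_table i j)"

definition K3_even :: "'a::field K3 set" where "K3_even = vec.span {e}"
definition K3_odd :: "'a::field K3 set" where "K3_odd = vec.span {z, w}"

(* As in the source, parity preservation is not part of the definition. *)
definition K3_automorphism :: "('a::field K3 \<Rightarrow> 'a K3) \<Rightarrow> bool" where
  "K3_automorphism \<phi> \<longleftrightarrow>
     Vector_Spaces.linear (*s) (*s) \<phi> \<and> bij \<phi> \<and> (\<forall>a b. \<phi> (a \<bullet>\<^sub>K b) = \<phi> a \<bullet>\<^sub>K \<phi> b)"

lemma K3_mult_basis:
  "e \<bullet>\<^sub>K e = (e :: 'a::field K3)"
  "e \<bullet>\<^sub>K z = (1/2) *s z + (1/2) *s (w :: 'a K3)"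
  "e \<bullet>\<^sub>K w = (1/2) *s (w :: 'a K3)"
  "z \<bullet>\<^sub>K e = (1/2) *s z - (1/2) *s (w :: 'a K3)"
  "w \<bullet>\<^sub>K e = (1/2) *s (w :: 'a K3)"
  "z \<bullet>\<^sub>K z = - (e :: 'a K3)"
  "z \<bullet>\<^sub>K w = (e :: 'a K3)"
  "w \<bullet>\<^sub>K z = - (e :: 'a K3)"
  "w \<bullet>\<^sub>K w = (0 :: 'a K3)"
  by (simp_all add: K3_mult_def UNIV_K3_index) (simp_all add: e_def z_def w_def axis_def)

lemma K3_expand: "x = x $ E *s e + x $ Z *s z + x $ W *s w"
  unfolding vec_eq_iff
proof
  fix i show "x $ i = (x $ E *s e + x $ Z *s z + x $ W *s w) $ i"
    by (cases i) (simp_all add: e_def z_def w_def axis_def)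
qed

lemma K3_even_iff: "x \<in> K3_even \<longleftrightarrow> x $ Z = 0 \<and> x $ W = 0"
proof
  assume "x \<in> K3_even"
  then show "x $ Z = 0 \<and> x $ W = 0"
    by (auto simp: K3_even_def vec.span_singleton e_def axis_def)
next
  assume "x $ Z = 0 \<and> x $ W = 0"
  then have "x = x $ E *s e" using K3_expand[of x] by simp
  then show "x \<in> K3_even"
    unfolding K3_even_def vec.span_singleton by blast
qed

lemma K3_odd_iff: "x \<in> K3_odd \<longleftrightarrow> x $ E = 0"
proof
  assume "x \<in> K3_odd"
  then show "x $ E = 0"
    unfolding K3_odd_def
    by (induction rule: vec.span_induct_alt) (auto simp: z_def w_def axis_def)
next
  assume "x $ E = 0"
  then have "x = x $ Z *s z + x $ W *s w" using K3_expand[of x] by simp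
  moreover have "\<dots> \<in> K3_odd"
    unfolding K3_odd_def by (intro vec.span_add vec.span_scale vec.span_base) auto
  ultimately show "x \<in> K3_odd" by simp
qed

lemma K3_superalgebra:
  fixes x y :: "'a::field K3"
  shows "K3_even \<inter> K3_odd = {0 :: 'a K3}"
    and "\<exists>a\<in>K3_even. \<exists>b\<in>K3_odd. x = a + b"
    and "x \<in> K3_even \<Longrightarrow> y \<in> K3_even \<Longrightarrow> x \<bullet>\<^sub>K y \<in> K3_even"
    and "x \<in> K3_even \<Longrightarrow> y \<in> K3_odd \<Longrightarrow> x \<bullet>\<^sub>K y \<in> K3_odd"
    and "x \<in> K3_odd \<Longrightarrow> y \<in> K3_even \<Longrightarrow> x \<bullet>\<^sub>K y \<in> K3_odd"
    and "x \<in> K3_odd \<Longrightarrow> y \<in> K3_odd \<Longrightarrow> x \<bullet>\<^sub>K y \<in> K3_even"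
proof -
  show "K3_even \<inter> K3_odd = {0 :: 'a K3}"
  proof (intro equalityI subsetI)
    fix v :: "'a K3" assume "v \<in> K3_even \<inter> K3_odd"
    then show "v \<in> {0}" using K3_expand[of v] by (simp add: K3_even_iff K3_odd_iff)
  qed (simp add: K3_even_iff K3_odd_iff)
  have "x $ E *s e \<in> K3_even" "x $ Z *s z + x $ W *s w \<in> K3_odd"
    by (simp_all add: K3_even_iff K3_odd_iff e_def z_def w_def axis_def)
  then show "\<exists>a\<in>K3_even. \<exists>b\<in>K3_odd. x = a + b"
    using K3_expand[of x] by (metis add.assoc)
qed (simp_all add: K3_even_iff K3_odd_iff K3_mult_def UNIV_K3_index e_def z_def w_def axis_def)

end

theory Submission
  imports Defs
begin

text \<open>The image of e is a nonzero idempotent, hence of the form e + c w. The eigenvalue equations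
  e w = w e = w/2 then force the image of w to be r w, the products z w = e = - w z give c = 0 and
  put the image of z into the odd part with z-coefficient 1/r, and e z = z/2 + w/2 makes that
  coefficient equal to r.\<close>

lemma K3_basis_nth [simp]:
  "e $ i = (if i = E then 1 else 0)"
  "z $ i = (if i = Z then 1 else 0)"
  "w $ i = (if i = W then 1 else 0)"
  by (auto simp: e_def z_def w_def axis_def)

lemma K3_eq_iff:
  fixes x y :: "'a K3"
  shows "x = y \<longleftrightarrow> x $ E = y $ E \<and> x $ Z = y $ Z \<and> x $ W = y $ W"
  unfolding vec_eq_iff by (metis K3_index.exhaust)

lemma K3_mult_nth:
  fixes x y :: "'a::field K3"
  shows "(x \<bullet>\<^sub>K y) $ E = x $ E * y $ E - x $ Z * y $ Z + x $ Z * y $ W - x $ W * y $ Z"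
    and "(x \<bullet>\<^sub>K y) $ Z = (x $ E * y $ Z + x $ Z * y $ E) / 2"
    and "(x \<bullet>\<^sub>K y) $ W = (x $ E * y $ Z + x $ E * y $ W - x $ Z * y $ E + x $ W * y $ E) / 2"
  by (simp_all add: K3_mult_def UNIV_K3_index add_divide_distrib diff_divide_distrib)

text \<open>In a square the mixed terms collapse, because \<open>e z + z e = z\<close>,
  \<open>e w + w e = w\<close> and \<open>z w + w z = 0\<close>. Squaring thus multiplies the odd
  part by the coefficient of \<open>e\<close>. If that coefficient is not 1, the odd part vanishes
  and the coefficient must be 0, so \<open>x = 0\<close>; if it is 1, the
  \<open>E\<close>-coordinate leaves a vanishing square. The \<open>W\<close>-coordinate stays
  free.\<close>

lemma K3_idempotent:
  fixes x :: "'a::field_char_0 K3"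
  assumes "x \<bullet>\<^sub>K x = x" "x \<noteq> 0"
  shows "x $ E = 1" "x $ Z = 0"
proof -
  have eqs: "x $ E * x $ E - x $ Z * x $ Z = x $ E"
    "x $ E * x $ Z = x $ Z" "x $ E * x $ W = x $ W"
    using assms(1) by (simp_all add: K3_eq_iff K3_mult_nth mult.commute)
  show 1: "x $ E = 1"
  proof (rule ccontr)
    assume "x $ E \<noteq> 1"
    with eqs(2,3) have "x $ Z = 0" "x $ W = 0" by simp_all
    with eqs(1) \<open>x $ E \<noteq> 1\<close> have "x $ E = 0" by simp
    with \<open>x $ Z = 0\<close> \<open>x $ W = 0\<close> assms(2) show False by (simp add: K3_eq_iff)
  qed
  show "x $ Z = 0" using eqs(1) 1 by simp
qed

lemma K3_automorphism_on_basis: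
  fixes \<phi> :: "'a::field_char_0 K3 \<Rightarrow> 'a K3"
  assumes "K3_automorphism \<phi>"
  obtains \<epsilon> k where "\<epsilon> \<in> {1, - 1}" "\<phi> e = e" "\<phi> z = \<epsilon> *s z + k *s w" "\<phi> w = \<epsilon> *s w"
proof -
  interpret Vector_Spaces.linear "(*s)" "(*s)" \<phi>
    using assms by (simp add: K3_automorphism_def)
  have inj: "inj \<phi>" and mult: "\<And>a b. \<phi> a \<bullet>\<^sub>K \<phi> b = \<phi> (a \<bullet>\<^sub>K b)"
    using assms by (auto simp: K3_automorphism_def bij_def)
  have "(e :: 'a K3) \<noteq> 0" by (simp add: K3_eq_iff)
  then have "\<phi> e \<noteq> 0" using inj by (metis injD zero)
  moreover have "\<phi> e \<bullet>\<^sub>K \<phi> e = \<phi> e" by (simp add: mult K3_mult_basis)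
  ultimately have a: "\<phi> e $ E = 1" and b: "\<phi> e $ Z = 0" by (simp_all add: K3_idempotent)
  have ew: "\<phi> e \<bullet>\<^sub>K \<phi> w = (1/2) *s \<phi> w" and we: "\<phi> w \<bullet>\<^sub>K \<phi> e = (1/2) *s \<phi> w"
    by (simp_all only: mult K3_mult_basis scale)
  have p1: "\<phi> w $ E - \<phi> e $ W * \<phi> w $ Z = \<phi> w $ E / 2"
    and p2: "\<phi> w $ E + \<phi> w $ Z * \<phi> e $ W = \<phi> w $ E / 2"
    using ew we by (simp_all add: K3_eq_iff K3_mult_nth a b)
  \<comment> \<open>In the sum of the two equations the cross terms cancel.\<close>
  have "2 * \<phi> w $ E = \<phi> w $ E" using p1 p2 by (simp add: field_simps)
  then have wE: "\<phi> w $ E = 0" by simp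
  \<comment> \<open>Since \<open>e z\<close> has a \<open>w\<close>-component, the
    \<open>W\<close>-coordinate of \<open>ew\<close> carries the extra summand
    \<open>\<phi> w $ Z / 2\<close>, which must vanish.\<close>
  have wZ: "\<phi> w $ Z = 0"
    using ew wE by (simp add: K3_eq_iff K3_mult_nth a b)
  have zw: "\<phi> z \<bullet>\<^sub>K \<phi> w = \<phi> e" and wz: "\<phi> w \<bullet>\<^sub>K \<phi> z = - \<phi> e"
    by (simp_all only: mult K3_mult_basis neg)
  have tr: "\<phi> z $ Z * \<phi> w $ W = 1" and c1: "\<phi> z $ E * \<phi> w $ W / 2 = \<phi> e $ W"
    and c2: "\<phi> w $ W * \<phi> z $ E / 2 = - \<phi> e $ W"
    using zw wz by (simp_all add: K3_eq_iff K3_mult_nth a b wE wZ)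
  \<comment> \<open>The two products have the same \<open>W\<close>-coordinate, but their values are
    opposite, so it is 0; by \<open>tr\<close> the factor \<open>\<phi> w $ W\<close> is
    invertible.\<close>
  have "2 * (\<phi> z $ E * \<phi> w $ W) = 0" using c1 c2 by (simp add: field_simps)
  then have zE: "\<phi> z $ E = 0" using tr by auto
  then have c: "\<phi> e $ W = 0" using c1 by simp
  have "\<phi> e \<bullet>\<^sub>K \<phi> z = (1/2) *s \<phi> z + (1/2) *s \<phi> w"
    by (simp only: mult K3_mult_basis scale add)
  \<comment> \<open>Read off from the \<open>W\<close>-coordinate, where \<open>\<phi> z $ W\<close>
    cancels; hence \<open>k\<close> is unconstrained. With \<open>tr\<close> the common value
    squares to 1.\<close>
  then have t: "\<phi> z $ Z = \<phi> w $ W"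
    by (simp add: K3_eq_iff K3_mult_nth a b c wE wZ zE add_divide_distrib)
  have "\<phi> w $ W \<in> {1, - 1}"
    using tr t by (simp add: square_eq_1_iff)
  moreover have "\<phi> e = e" "\<phi> z = \<phi> w $ W *s z + \<phi> z $ W *s w" "\<phi> w = \<phi> w $ W *s w"
    by (simp_all add: K3_eq_iff a b c t wE wZ zE)
  ultimately show thesis by (rule that)
qed

text \<open>In coordinates \<phi> is triangular with diagonal 1, \<epsilon>, \<epsilon>, hence
  injective, and surjective by finite dimension. Multiplicativity is a polynomial identity for each
  of the two signs: the terms in \<open>k\<close> cancel in the \<open>E\<close>-coordinate, and the
  others agree there because \<epsilon> squares to 1.\<close>

lemma K3_automorphism_of_basis:
  fixes \<phi> :: "'a::field_char_0 K3 \<Rightarrow> 'a K3"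
  assumes lin: "Vector_Spaces.linear (*s) (*s) \<phi>" and \<epsilon>: "\<epsilon> \<in> {1, - 1}"
    and basis: "\<phi> e = e" "\<phi> z = \<epsilon> *s z + k *s w" "\<phi> w = \<epsilon> *s w"
  shows "K3_automorphism \<phi>"
proof -
  interpret Vector_Spaces.linear "(*s)" "(*s)" \<phi> by (fact lin)
  have \<phi>: "\<phi> x = x $ E *s e + x $ Z *s (\<epsilon> *s z + k *s w) + x $ W *s (\<epsilon> *s w)" for x
    using arg_cong[OF K3_expand[of x], of \<phi>] by (simp only: add scale basis)
  have nth: "\<phi> x $ E = x $ E" "\<phi> x $ Z = x $ Z * \<epsilon>" "\<phi> x $ W = x $ Z * k + x $ W * \<epsilon>" for x
    by (simp_all add: \<phi>)
  have "\<epsilon> \<noteq> 0" using \<epsilon> by auto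
  have "inj \<phi>"
    using \<open>\<epsilon> \<noteq> 0\<close> by (auto intro!: injI simp: K3_eq_iff nth)
  moreover have "surj \<phi>"
    using lin \<open>inj \<phi>\<close> by (rule vec.linear_inj_imp_surj)
  moreover have "\<phi> (x \<bullet>\<^sub>K y) = \<phi> x \<bullet>\<^sub>K \<phi> y" for x y
    using \<epsilon> by (auto simp: K3_eq_iff nth K3_mult_nth field_simps)
  ultimately show ?thesis
    using lin by (simp add: K3_automorphism_def bij_def)
qed

theorem mainTheorem6:
  fixes \<phi> :: "'a::field_char_0 K3 \<Rightarrow> 'a K3"
  shows "K3_automorphism \<phi> \<longleftrightarrow>
    Vector_Spaces.linear (*s) (*s) \<phi> \<and>
    (\<exists>\<epsilon>\<in>{1, - 1}. \<exists>k. \<phi> e = e \<and> \<phi> z = \<epsilon> *s z + k *s w \<and> \<phi> w = \<epsilon> *s w)"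
proof
  assume "K3_automorphism \<phi>"
  then show "Vector_Spaces.linear (*s) (*s) \<phi> \<and>
    (\<exists>\<epsilon>\<in>{1, - 1}. \<exists>k. \<phi> e = e \<and> \<phi> z = \<epsilon> *s z + k *s w \<and> \<phi> w = \<epsilon> *s w)"
    by (metis K3_automorphism_on_basis K3_automorphism_def)
qed (metis K3_automorphism_of_basis)

end
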